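(* Let $k\ge 1$ be an integer and let $G$ be a graph with minimum degree $\delta(G)\ge k$. Then $G$ has a $2$-partition $(V_1,V_2)$ of $V(G)$ such that every vertex of $V_1$ has at least $1$ neighbour in $V_2$ and every vertex of $V_2$ has at least $k$ neighbours in $V_1$. Moreover, such a partition can be found in polynomial time.
   Context: A $2$-partition of a graph $G$ is a partition $(V_1,V_2)$ of $V(G)$ into two sets (one of which may be empty). *)

theory Defs
  imports
    "Graph_Theory.Pair_Digraph"
    "HOL-Library.Extended_Nat"
    "HOL-Computational_Algebra.Polynomial"
begin

section \<open>Degrees and 2-partitions\<close>

text \<open>
  Finite simple undirected graphs are the structures satisfying \<^const>\<open>pair_graph\<close>: the
  relation \<open>parcs G\<close> is then a symmetric and irreflexive adjacency relation on the finite
  set \<open>pverts G\<close>.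
\<close>

definition neighbours :: "'a pair_pre_digraph \<Rightarrow> 'a \<Rightarrow> 'a set" where
  "neighbours G v = {u. (v, u) \<in> parcs G}"

definition vertex_degree :: "'a pair_pre_digraph \<Rightarrow> 'a \<Rightarrow> nat" where
  "vertex_degree G v = card (neighbours G v)"

text \<open>
  The infimum is a minimum unless \<open>G\<close> has no vertices, in which case it is \<open>\<infinity>\<close>; so a lower
  bound on the minimum degree is vacuous for the null graph.
\<close>

definition min_degree :: "'a pair_pre_digraph \<Rightarrow> enat" where
  "min_degree G = (INF v\<in>pverts G. enat (vertex_degree G v))"

definition two_partition :: "'a pair_pre_digraph \<Rightarrow> 'a set \<Rightarrow> 'a set \<Rightarrow> bool" where
  "two_partition G V1 V2 \<longleftrightarrow> V1 \<union> V2 = pverts G \<and> V1 \<inter> V2 = {}"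

definition good_two_partition :: "nat \<Rightarrow> 'a pair_pre_digraph \<Rightarrow> 'a set \<Rightarrow> 'a set \<Rightarrow> bool" where
  "good_two_partition k G V1 V2 \<longleftrightarrow>
     two_partition G V1 V2 \<and>
     (\<forall>v\<in>V1. 1 \<le> card (neighbours G v \<inter> V2)) \<and>
     (\<forall>v\<in>V2. k \<le> card (neighbours G v \<inter> V1))"


section \<open>Deterministic multi-tape Turing machines\<close>

text \<open>
  Symbols and states are natural numbers below the bounds \<open>tm_symbols\<close> and \<open>tm_states\<close>; symbol
  \<open>0\<close> is the blank. Tapes are infinite in both directions.
\<close>

datatype move = Move_Left | Stay | Move_Right

record tm =
  tm_tapes :: nat
  tm_states :: nat
  tm_symbols :: nat
  tm_start :: nat
  tm_halt :: nat
  tm_trans :: "nat \<Rightarrow> nat list \<Rightarrow> nat \<times> (nat \<times> move) list"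

text \<open>
  Finiteness of the machine lies in the bounds below: the values of \<open>tm_trans\<close> outside the
  finitely many arguments considered here are never used in a computation whose input word
  consists of symbols of the machine.
\<close>

definition wf_tm :: "tm \<Rightarrow> bool" where
  "wf_tm M \<longleftrightarrow>
     1 \<le> tm_tapes M \<and> 0 < tm_symbols M \<and>
     tm_start M < tm_states M \<and> tm_halt M < tm_states M \<and>
     (\<forall>q rs. q < tm_states M \<and> length rs = tm_tapes M \<and> set rs \<subseteq> {..<tm_symbols M} \<longrightarrow>
        (case tm_trans M q rs of (q', acts) \<Rightarrow>
           q' < tm_states M \<and> length acts = tm_tapes M \<and>
           fst ` set acts \<subseteq> {..<tm_symbols M}))"

type_synonym tape = "(int \<Rightarrow> nat) \<times> int"

type_synonym config = "nat \<times> tape list"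

fun read_tape :: "tape \<Rightarrow> nat" where
  "read_tape (c, h) = c h"

fun move_head :: "move \<Rightarrow> int \<Rightarrow> int" where
  "move_head Move_Left h = h - 1"
| "move_head Stay h = h"
| "move_head Move_Right h = h + 1"

fun act_tape :: "nat \<times> move \<Rightarrow> tape \<Rightarrow> tape" where
  "act_tape (a, m) (c, h) = (c(h := a), move_head m h)"

fun tm_step :: "tm \<Rightarrow> config \<Rightarrow> config" where
  "tm_step M (q, ts) =
     (if q = tm_halt M then (q, ts)
      else (case tm_trans M q (map read_tape ts) of (q', acts) \<Rightarrow> (q', map2 act_tape acts ts)))"

definition word_cells :: "nat list \<Rightarrow> int \<Rightarrow> nat" where
  "word_cells w i = (if 0 \<le> i \<and> i < int (length w) then w ! nat i else 0)"

definition tm_init :: "tm \<Rightarrow> nat list \<Rightarrow> config" where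
  "tm_init M x =
     (tm_start M, (word_cells x, 0) # replicate (tm_tapes M - 1) (word_cells [], 0))"

text \<open>The input is on the first tape, the output on the last one.\<close>

definition tm_computes_within :: "tm \<Rightarrow> nat list \<Rightarrow> nat list \<Rightarrow> nat \<Rightarrow> bool" where
  "tm_computes_within M x y t \<longleftrightarrow>
     (case (tm_step M ^^ t) (tm_init M x) of (q, ts) \<Rightarrow>
        q = tm_halt M \<and> fst (last ts) = word_cells y)"


section \<open>Encoding of instances and solutions\<close>

text \<open>
  Words are over the symbols \<open>1\<close> (bit zero), \<open>2\<close> (bit one) and \<open>3\<close> (separator). An instance
  consists of \<open>k\<close> in binary, least significant bit first, and the adjacency matrix of a graph
  with vertex set \<open>{..<n}\<close>, row by row. A 2-partition is encoded by the characteristic bit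
  vector of its second part.
\<close>

definition bit_sym :: "bool \<Rightarrow> nat" where
  "bit_sym b = (if b then 2 else 1)"

definition sep_sym :: nat where
  "sep_sym = 3"

fun binary :: "nat \<Rightarrow> nat list" where
  "binary k = (if k = 0 then [] else bit_sym (odd k) # binary (k div 2))"

declare binary.simps [simp del]

definition encode_instance :: "nat \<Rightarrow> nat \<Rightarrow> nat pair_pre_digraph \<Rightarrow> nat list" where
  "encode_instance k n G =
     binary k @ [sep_sym] @
     concat (map (\<lambda>u. map (\<lambda>v. bit_sym ((u, v) \<in> parcs G)) [0..<n] @ [sep_sym]) [0..<n])"

definition encode_partition :: "nat \<Rightarrow> nat set \<Rightarrow> nat list" where
  "encode_partition n V2 = map (\<lambda>v. bit_sym (v \<in> V2)) [0..<n]"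

end

theory Submission
  imports Defs
begin

text \<open>
  Let \<open>V2\<close> be a maximal independent set and \<open>V1\<close> its complement. All of the at least \<open>k\<close>
  neighbours of a vertex of \<open>V2\<close> lie in \<open>V1\<close>, and by maximality every vertex of \<open>V1\<close> has a
  neighbour in \<open>V2\<close>. The greedy algorithm that scans the vertices in order produces such a set,
  and a two-tape machine implements it in one pass over the adjacency matrix: at row \<open>u\<close> the output
  tape holds the characteristic vector of the set chosen among the vertices below \<open>u\<close>, and the
  machine compares it cell by cell with the row.
\<close>

section \<open>Maximal independent sets\<close>

definition independent_set :: "'a pair_pre_digraph \<Rightarrow> 'a set \<Rightarrow> bool" where
  "independent_set G S \<longleftrightarrow> S \<subseteq> pverts G \<and> (\<forall>u\<in>S. \<forall>v\<in>S. (u, v) \<notin> parcs G)"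

text \<open>Only domination is asked of \<open>S\<close>, not maximality under inclusion, so the
  same lemma serves an inclusion-maximal set and the greedy one.\<close>

lemma good_two_partition_independent_dominating:
  assumes G: "pair_graph G" and k: "enat k \<le> min_degree G"
    and S: "independent_set G S"
    and dom: "\<And>v. v \<in> pverts G - S \<Longrightarrow> \<exists>u\<in>S. (v, u) \<in> parcs G"
  shows "good_two_partition k G (pverts G - S) S"
proof -
  interpret pair_graph G by (rule G)
  have sub: "neighbours G v \<subseteq> pverts G" for v
    by (auto simp: neighbours_def dest: in_arcsD2)
  have fin: "finite (neighbours G v)" for v
    using sub by (rule finite_subset) simp
  have "1 \<le> card (neighbours G v \<inter> S)" if v: "v \<in> pverts G - S" for v
  proof -
    from dom[OF v] have "neighbours G v \<inter> S \<noteq> {}" by (auto simp: neighbours_def)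
    then have "0 < card (neighbours G v \<inter> S)" using fin by (simp add: card_gt_0_iff)
    then show ?thesis by simp
  qed
  moreover have "k \<le> card (neighbours G v \<inter> (pverts G - S))" if v: "v \<in> S" for v
  proof -
    have "neighbours G v \<inter> (pverts G - S) = neighbours G v"
      using sub[of v] S v by (auto simp: independent_set_def neighbours_def)
    moreover have "enat k \<le> enat (vertex_degree G v)"
      using k S v unfolding min_degree_def le_INF_iff by (auto simp: independent_set_def)
    ultimately show ?thesis by (simp add: vertex_degree_def)
  qed
  ultimately show ?thesis
    using S by (auto simp: good_two_partition_def two_partition_def independent_set_def)
qed

text \<open>Covers arbitrary vertex types, where no order is at hand for a greedy scan; finiteness
  of the vertex set supplies an inclusion-maximal independent set instead.\<close>

lemma ex_maximal_independent_set:
  assumes G: "pair_graph G"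
  shows "\<exists>S. independent_set G S \<and> (\<forall>v\<in>pverts G - S. \<exists>u\<in>S. (v, u) \<in> parcs G)"
proof -
  interpret pair_graph G by (rule G)
  have sym: "(u, v) \<in> parcs G \<Longrightarrow> (v, u) \<in> parcs G" for u v
    using sym_arcs by (auto simp: symmetric_def elim: symE)
  have irr: "(v, v) \<notin> parcs G" for v using no_loops'[of v v] by auto
  have "finite {S. independent_set G S}"
    by (rule finite_subset[of _ "Pow (pverts G)"]) (auto simp: independent_set_def)
  moreover have "{} \<in> {S. independent_set G S}" by (simp add: independent_set_def)
  ultimately obtain S where S: "independent_set G S"
    and max: "\<And>T. independent_set G T \<Longrightarrow> S \<subseteq> T \<Longrightarrow> S = T"
    using finite_has_maximal[of "{S. independent_set G S}"] by blast
  have "\<exists>u\<in>S. (v, u) \<in> parcs G" if v: "v \<in> pverts G - S" for v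
  proof (rule ccontr)
    assume "\<not> ?thesis"
    \<comment> \<open>\<open>sym\<close> rules out arcs from \<open>S\<close> into \<open>v\<close>,
      and \<open>irr\<close> the loop at \<open>v\<close>.\<close>
    then have "independent_set G (insert v S)"
      using S v sym irr by (auto simp: independent_set_def)
    then have "S = insert v S" by (rule max) auto
    then show False using v by auto
  qed
  then show ?thesis using S by blast
qed

text \<open>The lexicographically first maximal independent set. The decision on \<open>u\<close>
  depends only on arcs from \<open>u\<close> to earlier choices, all found in row \<open>u\<close>
  of the matrix.\<close>

primrec greedy_set :: "nat rel \<Rightarrow> nat \<Rightarrow> nat set" where
  "greedy_set E 0 = {}"
| "greedy_set E (Suc u) =
     (if \<exists>v\<in>greedy_set E u. (u, v) \<in> E then greedy_set E u else insert u (greedy_set E u))"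

lemma greedy_set_subset: "greedy_set E n \<subseteq> {..<n}"
  by (induction n) (auto simp: less_Suc_eq)

text \<open>A new vertex is tested in the direction of its outgoing arcs only; symmetry gives the
  other direction and irreflexivity the pair of the vertex with itself.\<close>

lemma greedy_set_independent:
  assumes "sym E" "irrefl E"
  shows "u \<in> greedy_set E n \<Longrightarrow> v \<in> greedy_set E n \<Longrightarrow> (u, v) \<notin> E"
  using assms by (induction n) (auto simp: irrefl_def split: if_splits dest: symD)

text \<open>A vertex rejected at its turn had a chosen neighbour, and chosen vertices are never
  dropped.\<close>

lemma greedy_set_dominating:
  "v < n \<Longrightarrow> v \<notin> greedy_set E n \<Longrightarrow> \<exists>u\<in>greedy_set E n. (v, u) \<in> E"
  by (induction n) (auto simp: less_Suc_eq split: if_splits)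

lemma good_two_partition_greedy_set:
  assumes G: "pair_graph G" and V: "pverts G = {..<n}" and k: "enat k \<le> min_degree G"
  shows "good_two_partition k G (pverts G - greedy_set (parcs G) n) (greedy_set (parcs G) n)"
proof (rule good_two_partition_independent_dominating[OF G k])
  interpret pair_graph G by (rule G)
  have "sym (parcs G)" using sym_arcs by (simp add: symmetric_def)
  moreover have "irrefl (parcs G)" using no_loops' by (auto simp: irrefl_def)
  ultimately show "independent_set G (greedy_set (parcs G) n)"
    using greedy_set_independent greedy_set_subset by (simp add: independent_set_def V)
qed (use greedy_set_dominating V in auto)


section \<open>Cells of the input and output words\<close>

lemma word_cells_append:
  "word_cells (xs @ ys) i =
     (if i < int (length xs) then word_cells xs i else word_cells ys (i - int (length xs)))"
  by (auto simp: word_cells_def nth_append nat_diff_distrib zless_nat_eq_int_zless nat_less_iff)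

text \<open>Writing into the first blank cell after a word appends a letter; this is how the output
  grows.\<close>

lemma word_cells_snoc: "word_cells (xs @ [a]) = (word_cells xs)(int (length xs) := a)"
  by (auto simp: fun_eq_iff word_cells_append) (auto simp: word_cells_def)

lemma word_cells_nth: "i < length xs \<Longrightarrow> word_cells xs (int i) = xs ! i"
  by (simp add: word_cells_def)

lemma word_cells_outside: "i < 0 \<or> int (length xs) \<le> i \<Longrightarrow> word_cells xs i = 0"
  by (auto simp: word_cells_def)

lemma bit_sym_neq [simp]: "bit_sym b \<noteq> 0" "bit_sym b \<noteq> 3"
  by (simp_all add: bit_sym_def)

lemma bit_sym_eq_2 [simp]: "bit_sym b = 2 \<longleftrightarrow> b"
  by (simp add: bit_sym_def)

lemma binary_no_sep: "3 \<notin> set (binary k)"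
proof (induction k rule: binary.induct)
  case (1 k)
  then show ?case by (subst binary.simps) (auto simp: bit_sym_neq(2)[symmetric])
qed

definition row_word :: "nat \<Rightarrow> nat rel \<Rightarrow> nat \<Rightarrow> nat list" where
  "row_word n E u = map (\<lambda>v. bit_sym ((u, v) \<in> E)) [0..<n] @ [sep_sym]"

lemma length_row_word [simp]: "length (row_word n E u) = Suc n"
  by (simp add: row_word_def)

lemma length_rows [simp]: "length (concat (map (row_word n E) us)) = length us * Suc n"
  by (induction us) auto

lemma encode_instance_rows:
  "encode_instance k n G = binary k @ sep_sym # concat (map (row_word n (parcs G)) [0..<n])"
  by (simp add: encode_instance_def row_word_def[abs_def])

lemma length_encode_instance:
  "length (encode_instance k n G) = length (binary k) + Suc (n * Suc n)"
  by (simp add: encode_instance_rows)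

definition row_start :: "nat \<Rightarrow> nat \<Rightarrow> nat \<Rightarrow> nat" where
  "row_start k n u = Suc (length (binary k)) + u * Suc n"

lemma encode_instance_row:
  assumes "u < n" "v \<le> n"
  shows "word_cells (encode_instance k n G) (int (row_start k n u) + int v) =
    row_word n (parcs G) u ! v"
proof -
  have "[0..<n] = [0..<u] @ u # [Suc u..<n]"
    using assms by (metis less_imp_add_positive upt_add_eq_append upt_conv_Cons zero_le)
  then have eq: "encode_instance k n G =
      (binary k @ sep_sym # concat (map (row_word n (parcs G)) [0..<u])) @
      row_word n (parcs G) u @ concat (map (row_word n (parcs G)) [Suc u..<n])"
    by (simp add: encode_instance_rows)
  show ?thesis
    unfolding eq using assms
    by (subst word_cells_append, subst word_cells_append)
      (simp add: row_start_def word_cells_nth del: of_nat_Suc of_nat_mult mult_Suc_right)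
qed

lemma encode_instance_bit:
  "u < n \<Longrightarrow> v < n \<Longrightarrow>
    word_cells (encode_instance k n G) (int (row_start k n u) + int v) =
    bit_sym ((u, v) \<in> parcs G)"
  by (simp add: encode_instance_row) (simp add: row_word_def nth_append)

lemma encode_instance_sep:
  "u < n \<Longrightarrow> word_cells (encode_instance k n G) (int (row_start k n u) + int n) = 3"
  by (simp add: encode_instance_row) (simp add: row_word_def nth_append sep_sym_def)

text \<open>Row \<open>n\<close> would start just behind the input, so a blank read at the start of
  a row signals that all rows are done.\<close>

lemma encode_instance_end:
  "word_cells (encode_instance k n G) (int (row_start k n n)) = 0"
  by (rule word_cells_outside) (simp add: row_start_def length_encode_instance)

lemma encode_instance_binary:
  assumes "i < length (binary k)"
  shows "word_cells (encode_instance k n G) (int i) \<noteq> 3"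
proof -
  have "word_cells (encode_instance k n G) (int i) = binary k ! i"
    using assms by (simp add: encode_instance_rows word_cells_append word_cells_nth)
  then show ?thesis using assms binary_no_sep nth_mem by metis
qed

lemma encode_instance_binary_end:
  "word_cells (encode_instance k n G) (int (length (binary k))) = 3"
  using word_cells_nth[of "length (binary k)" "encode_instance k n G"]
  by (simp add: encode_instance_rows sep_sym_def)

lemma length_encode_partition [simp]: "length (encode_partition n S) = n"
  by (simp add: encode_partition_def)

lemma encode_partition_cell:
  "v < n \<Longrightarrow> word_cells (encode_partition n S) (int v) = bit_sym (v \<in> S)"
  by (simp add: word_cells_nth) (simp add: encode_partition_def)

text \<open>The two sets may differ from \<open>n\<close> on, as consecutive greedy sets do.\<close>

lemma encode_partition_Suc:
  assumes "S \<inter> {..<n} = T \<inter> {..<n}"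
  shows "encode_partition (Suc n) S = encode_partition n T @ [bit_sym (n \<in> S)]"
proof -
  have "v \<in> S \<longleftrightarrow> v \<in> T" if "v < n" for v using assms that by blast
  then show ?thesis by (simp add: encode_partition_def)
qed


section \<open>The machine\<close>

text \<open>
  State 0 skips \<open>k\<close>. States 1 and 2 compare a row with the output, state 2 recording that a
  neighbour already chosen has been seen; at the first blank output cell the bit of the current
  vertex is written. State 3 runs to the end of the row, state 4 rewinds the output tape to the blank
  in cell \<open>-1\<close>, and state 5 halts.
\<close>

definition greedy_trans :: "nat \<Rightarrow> nat \<Rightarrow> nat \<Rightarrow> nat \<times> (nat \<times> move) list" where
  "greedy_trans q a b =
    (if q = 0 then (if a = 3 then 1 else 0, [(a, Move_Right), (b, Stay)])
     else if q = 1 then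
       (if a = 0 then (5, [(a, Stay), (b, Stay)])
        else if b = 0 then (3, [(a, Stay), (2, Stay)])
        else (if a = 2 \<and> b = 2 then 2 else 1, [(a, Move_Right), (b, Move_Right)]))
     else if q = 2 then
       (if b = 0 then (3, [(a, Stay), (1, Stay)])
        else (2, [(a, Move_Right), (b, Move_Right)]))
     else if q = 3 then
       (if a = 3 then (4, [(a, Stay), (b, Stay)]) else (3, [(a, Move_Right), (b, Stay)]))
     else if q = 4 then
       (if b = 0 then (1, [(a, Move_Right), (b, Move_Right)])
        else (4, [(a, Stay), (b, Move_Left)]))
     else (5, [(a, Stay), (b, Stay)]))"

definition greedy_tm :: tm where
  "greedy_tm =
    \<lparr>tm_tapes = 2, tm_states = 6, tm_symbols = 4, tm_start = 0, tm_halt = 5,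
     tm_trans = (\<lambda>q rs. greedy_trans q (rs ! 0) (rs ! 1))\<rparr>"

lemma wf_greedy_tm: "wf_tm greedy_tm"
proof -
  have "case greedy_trans q (rs ! 0) (rs ! 1) of (q', acts) \<Rightarrow>
      q' < 6 \<and> length acts = 2 \<and> fst ` set acts \<subseteq> {..<4}"
    if "length rs = 2" "set rs \<subseteq> {..<4}" for q rs
  proof -
    have "rs ! 0 < 4" "rs ! 1 < 4" using that nth_mem[of 0 rs] nth_mem[of 1 rs]
      by (simp_all add: subset_iff)
    then show ?thesis by (simp add: greedy_trans_def)
  qed
  then show ?thesis by (simp add: wf_tm_def greedy_tm_def)
qed

section \<open>Runs of the single phases of the machine\<close>

abbreviation greedy_step :: "config \<Rightarrow> config" where
  "greedy_step \<equiv> tm_step greedy_tm"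

lemma greedy_step_simp:
  "greedy_step (q, [(X, g), (Y, h)]) =
    (if q = 5 then (q, [(X, g), (Y, h)])
     else case greedy_trans q (X g) (Y h) of
       (q', acts) \<Rightarrow> (q', map2 act_tape acts [(X, g), (Y, h)]))"
  by (simp add: greedy_tm_def)

lemma funpow_trans: "(f ^^ s) x = y \<Longrightarrow> (f ^^ t) y = z \<Longrightarrow> (f ^^ (s + t)) x = z"
  by (simp add: funpow_add add.commute[of s])

lemma funpow_trans1: "(f ^^ s) x = y \<Longrightarrow> f y = z \<Longrightarrow> (f ^^ Suc s) x = z"
  by simp

lemma greedy_skip_number:
  assumes "\<forall>i<j. X (int i) \<noteq> 3"
  shows "(greedy_step ^^ j) (0, [(X, 0), (Y, h)]) = (0, [(X, int j), (Y, h)])"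
  using assms
proof (induction j)
  case (Suc j)
  then have "(greedy_step ^^ j) (0, [(X, 0), (Y, h)]) = (0, [(X, int j), (Y, h)])" by simp
  then show ?case
  proof (rule funpow_trans1)
    show "greedy_step (0, [(X, int j), (Y, h)]) = (0, [(X, int (Suc j)), (Y, h)])"
      using Suc.prems
      by (simp add: greedy_step_simp greedy_trans_def less_Suc_eq ac_simps del: tm_step.simps)
  qed
qed simp

text \<open>State 2 is kept as long as the output cells are nonblank, so the state stores the
  disjunction of the tests made so far. Symbol \<open>2\<close> on both tapes means an arc to a
  chosen vertex.\<close>

lemma greedy_scan:
  assumes "\<forall>i<j. X (g + int i) \<noteq> 0 \<and> Y (int i) \<noteq> 0"
  shows "(greedy_step ^^ j) (1, [(X, g), (Y, 0)]) =
    (if \<exists>i<j. X (g + int i) = 2 \<and> Y (int i) = 2 then 2 else 1,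
     [(X, g + int j), (Y, int j)])"
  using assms
proof (induction j)
  case (Suc j)
  define c where "c \<longleftrightarrow> (\<exists>i<j. X (g + int i) = 2 \<and> Y (int i) = 2)"
  have c_Suc: "(\<exists>i<Suc j. X (g + int i) = 2 \<and> Y (int i) = 2) \<longleftrightarrow>
      c \<or> X (g + int j) = 2 \<and> Y (int j) = 2"
    unfolding c_def less_Suc_eq by blast
  have "(greedy_step ^^ j) (1, [(X, g), (Y, 0)]) =
      (if c then 2 else 1, [(X, g + int j), (Y, int j)])"
    using Suc by (simp add: c_def)
  then show ?case
    unfolding c_Suc
  proof (rule funpow_trans1)
    have "X (g + int j) \<noteq> 0" "Y (int j) \<noteq> 0" using Suc.prems by auto
    then show "greedy_step (if c then 2 else 1, [(X, g + int j), (Y, int j)]) =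
        (if c \<or> X (g + int j) = 2 \<and> Y (int j) = 2 then 2 else 1,
         [(X, g + int (Suc j)), (Y, int (Suc j))])"
      \<comment> \<open>The two cases are the states 2 and 1; \<open>fun_upd_idem\<close> removes
        the rewriting of a symbol by itself.\<close>
      by (cases c)
        (simp_all add: greedy_step_simp greedy_trans_def fun_upd_idem ac_simps
          del: tm_step.simps)
  qed
qed simp

lemma greedy_skip_row:
  assumes "\<forall>i<j. X (g + int i) \<noteq> 3"
  shows "(greedy_step ^^ j) (3, [(X, g), (Y, h)]) = (3, [(X, g + int j), (Y, h)])"
  using assms
proof (induction j)
  case (Suc j)
  then have "(greedy_step ^^ j) (3, [(X, g), (Y, h)]) = (3, [(X, g + int j), (Y, h)])" by simp
  then show ?case
  proof (rule funpow_trans1)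
    show "greedy_step (3, [(X, g + int j), (Y, h)]) = (3, [(X, g + int (Suc j)), (Y, h)])"
      using Suc.prems
      by (simp add: greedy_step_simp greedy_trans_def less_Suc_eq ac_simps del: tm_step.simps)
  qed
qed simp

lemma greedy_rewind:
  assumes "\<forall>i<j. Y (h - int i) \<noteq> 0"
  shows "(greedy_step ^^ j) (4, [(X, g), (Y, h)]) = (4, [(X, g), (Y, h - int j)])"
  using assms
proof (induction j)
  case (Suc j)
  then have "(greedy_step ^^ j) (4, [(X, g), (Y, h)]) = (4, [(X, g), (Y, h - int j)])" by simp
  then show ?case
  proof (rule funpow_trans1)
    show "greedy_step (4, [(X, g), (Y, h - int j)]) = (4, [(X, g), (Y, h - int (Suc j))])"
      using Suc.prems
      by (simp add: greedy_step_simp greedy_trans_def less_Suc_eq ac_simps del: tm_step.simps)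
  qed
qed simp

section \<open>One row, all rows, and the complete run\<close>

text \<open>The loop invariant at the moment when row \<open>u\<close> is about to be read.\<close>

definition row_config :: "nat \<Rightarrow> nat \<Rightarrow> nat pair_pre_digraph \<Rightarrow> nat \<Rightarrow> config" where
  "row_config k n G u =
    (1, [(word_cells (encode_instance k n G), int (row_start k n u)),
         (word_cells (encode_partition u (greedy_set (parcs G) u)), 0)])"

text \<open>The steps are \<open>u\<close> for comparing, 1 for writing the bit,
  \<open>n - u\<close> for reaching the separator, 1 for entering state 4, \<open>u + 1\<close> for
  rewinding and 1 for moving to the next row.\<close>

lemma greedy_row:
  assumes u: "u < n"
  shows "(greedy_step ^^ (n + u + 4)) (row_config k n G u) = row_config k n G (Suc u)"
proof -
  let ?E = "parcs G"
  define X where "X = word_cells (encode_instance k n G)"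
  define g where "g = int (row_start k n u)"
  define Y where "Y = word_cells (encode_partition u (greedy_set ?E u))"
  define Y' where "Y' = word_cells (encode_partition (Suc u) (greedy_set ?E (Suc u)))"
  define q where "q = (if \<exists>v\<in>greedy_set ?E u. (u, v) \<in> ?E then 2 else 1 :: nat)"
  have X: "X (g + int v) = bit_sym ((u, v) \<in> ?E)" if "v < n" for v
    using encode_instance_bit[OF u that] by (simp add: X_def g_def)
  have Xn: "X (g + int n) = 3"
    using encode_instance_sep[OF u] by (simp add: X_def g_def)
  have Y: "Y (int v) = bit_sym (v \<in> greedy_set ?E u)" if "v < u" for v
    using that by (simp add: Y_def encode_partition_cell)
  have Yu: "Y (int u) = 0" by (simp add: Y_def word_cells_outside)
  have Y'_nz: "Y' (int v) \<noteq> 0" if "v \<le> u" for v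
    using that by (simp add: Y'_def encode_partition_cell del: greedy_set.simps)
  \<comment> \<open>This blank stops the rewinding.\<close>
  have Y'_left: "Y' (-1) = 0" by (simp add: Y'_def word_cells_outside)
  have lt: "v < u" if "v \<in> greedy_set ?E u" for v
    using that greedy_set_subset by blast
  have "greedy_set ?E (Suc u) \<inter> {..<u} = greedy_set ?E u \<inter> {..<u}" by auto
  then have "encode_partition (Suc u) (greedy_set ?E (Suc u)) =
      encode_partition u (greedy_set ?E u) @ [bit_sym (u \<in> greedy_set ?E (Suc u))]"
    by (rule encode_partition_Suc)
  then have Y'_upd: "Y' = Y(int u := bit_sym (u \<in> greedy_set ?E (Suc u)))"
    by (simp add: Y_def Y'_def word_cells_snoc del: greedy_set.simps)
  have "(\<exists>i<u. X (g + int i) = 2 \<and> Y (int i) = 2) \<longleftrightarrow> (\<exists>v\<in>greedy_set ?E u. (u, v) \<in> ?E)"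
  proof
    assume "\<exists>v\<in>greedy_set ?E u. (u, v) \<in> ?E"
    then obtain v where "v \<in> greedy_set ?E u" "(u, v) \<in> ?E" by blast
    then have "v < u \<and> X (g + int v) = 2 \<and> Y (int v) = 2"
      using lt[of v] X[of v] Y[of v] u by simp
    then show "\<exists>i<u. X (g + int i) = 2 \<and> Y (int i) = 2" by blast
  qed (use X Y u in auto)
  then have "(greedy_step ^^ u) (1, [(X, g), (Y, 0)]) = (q, [(X, g + int u), (Y, int u)])"
    using greedy_scan[of u X g Y] X Y u by (simp add: q_def)
  then have "(greedy_step ^^ Suc u) (1, [(X, g), (Y, 0)]) =
      (3, [(X, g + int u), (Y', int u)])"
  proof (rule funpow_trans1)
    \<comment> \<open>Hence \<open>u\<close> enters the set at its own turn or never, and the bit to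
      write is the negation of the flag stored in the state \<open>q\<close>.\<close>
    have "u \<notin> greedy_set ?E u" using lt by blast
    then show "greedy_step (q, [(X, g + int u), (Y, int u)]) =
        (3, [(X, g + int u), (Y', int u)])"
      using X[OF u] Yu
      by (auto simp: greedy_step_simp greedy_trans_def q_def Y'_upd bit_sym_def
          simp del: tm_step.simps)
  qed
  moreover have "(greedy_step ^^ (n - u)) (3, [(X, g + int u), (Y', int u)]) =
      (3, [(X, g + int n), (Y', int u)])"
  proof -
    \<comment> \<open>The cells passed hold the entries \<open>u\<close> to \<open>n - 1\<close> of
      the row, which are bits.\<close>
    have "\<forall>i<n - u. X (g + int u + int i) \<noteq> 3"
      using X[of "u + i" for i] by (simp add: add.assoc flip: of_nat_add)
    from greedy_skip_row[OF this] show ?thesis using u by (simp add: of_nat_diff)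
  qed
  ultimately have "(greedy_step ^^ (Suc u + (n - u))) (1, [(X, g), (Y, 0)]) =
      (3, [(X, g + int n), (Y', int u)])"
    by (rule funpow_trans)
  then have "(greedy_step ^^ Suc (Suc u + (n - u))) (1, [(X, g), (Y, 0)]) =
      (4, [(X, g + int n), (Y', int u)])"
    by (rule funpow_trans1)
      (simp add: greedy_step_simp greedy_trans_def fun_upd_idem Xn del: tm_step.simps)
  \<comment> \<open>The cells \<open>u\<close> down to 0 are nonblank, including the one just
    written, so the head stops at cell -1.\<close>
  moreover have "(greedy_step ^^ Suc u) (4, [(X, g + int n), (Y', int u)]) =
      (4, [(X, g + int n), (Y', -1)])"
  proof -
    have "\<forall>i<Suc u. Y' (int u - int i) \<noteq> 0"
    proof (intro allI impI)
      fix i assume "i < Suc u"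
      then have "int u - int i = int (u - i)" by simp
      then show "Y' (int u - int i) \<noteq> 0" using Y'_nz[of "u - i"] by (metis diff_le_self)
    qed
    from greedy_rewind[OF this] show ?thesis by simp
  qed
  ultimately have "(greedy_step ^^ (Suc (Suc u + (n - u)) + Suc u)) (1, [(X, g), (Y, 0)]) =
      (4, [(X, g + int n), (Y', -1)])"
    by (rule funpow_trans)
  then have "(greedy_step ^^ Suc (Suc (Suc u + (n - u)) + Suc u)) (1, [(X, g), (Y, 0)]) =
      (1, [(X, g + int n + 1), (Y', 0)])"
    by (rule funpow_trans1)
      (simp add: greedy_step_simp greedy_trans_def fun_upd_idem Y'_left del: tm_step.simps)
  moreover have "Suc (Suc (Suc u + (n - u)) + Suc u) = n + u + 4" using u by simp
  moreover have "g + int n + 1 = int (row_start k n (Suc u))"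
    by (simp add: g_def row_start_def)
  ultimately show ?thesis
    unfolding row_config_def X_def Y_def Y'_def g_def by (simp only:)
qed

text \<open>Each row \<open>u < n\<close> costs \<open>n + u + 4 \<le> 2 * n + 4\<close>
  steps.\<close>

lemma greedy_rows:
  "u \<le> n \<Longrightarrow> \<exists>t \<le> u * (2 * n + 4).
    (greedy_step ^^ t) (row_config k n G 0) = row_config k n G u"
proof (induction u)
  case 0
  show ?case by simp
next
  case (Suc u)
  then obtain t where t: "t \<le> u * (2 * n + 4)"
    "(greedy_step ^^ t) (row_config k n G 0) = row_config k n G u"
    by auto
  have "u < n" using Suc.prems by simp
  from funpow_trans[OF t(2) greedy_row[OF this]]
  have "(greedy_step ^^ (t + (n + u + 4))) (row_config k n G 0) = row_config k n G (Suc u)" .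
  moreover have "t + (n + u + 4) \<le> Suc u * (2 * n + 4)" using t(1) Suc.prems by simp
  ultimately show ?case by blast
qed

lemma greedy_tm_computes:
  "\<exists>t \<le> length (binary k) + n * (2 * n + 4) + 2.
    tm_computes_within greedy_tm (encode_instance k n G)
      (encode_partition n (greedy_set (parcs G) n)) t"
proof -
  let ?X = "word_cells (encode_instance k n G)"
  let ?l = "length (binary k)"
  let ?c = "tm_init greedy_tm (encode_instance k n G)"
  have c: "?c = (0, [(?X, 0), (word_cells [], 0)])"
    by (simp add: tm_init_def greedy_tm_def)
  have "(greedy_step ^^ ?l) ?c = (0, [(?X, int ?l), (word_cells [], 0)])"
    unfolding c by (rule greedy_skip_number) (simp add: encode_instance_binary)
  \<comment> \<open>The separator after \<open>k\<close> switches to state 1; the empty output tape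
    encodes the empty greedy set.\<close>
  then have "(greedy_step ^^ Suc ?l) ?c = row_config k n G 0"
    by (rule funpow_trans1)
      (simp add: greedy_step_simp greedy_trans_def fun_upd_idem encode_instance_binary_end
        row_config_def
        row_start_def encode_partition_def del: tm_step.simps)
  moreover obtain t where t: "t \<le> n * (2 * n + 4)"
    "(greedy_step ^^ t) (row_config k n G 0) = row_config k n G n"
    using greedy_rows[of n n k G] by auto
  ultimately have "(greedy_step ^^ (Suc ?l + t)) ?c = row_config k n G n"
    by (intro funpow_trans)
  \<comment> \<open>The blank behind the last row sends state 1 to the halting state.\<close>
  then have "(greedy_step ^^ Suc (Suc ?l + t)) ?c = (5, snd (row_config k n G n))"
    by (rule funpow_trans1)
      (simp add: greedy_step_simp greedy_trans_def fun_upd_idem encode_instance_end row_config_def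
        del: tm_step.simps)
  then have "tm_computes_within greedy_tm (encode_instance k n G)
      (encode_partition n (greedy_set (parcs G) n)) (Suc (Suc ?l + t))"
    unfolding tm_computes_within_def by (simp only:) (simp add: row_config_def greedy_tm_def)
  moreover have "Suc (Suc ?l + t) \<le> ?l + n * (2 * n + 4) + 2" using t(1) by simp
  ultimately show ?thesis by blast
qed

section \<open>Existence for all vertex types, and the polynomial time bound\<close>

theorem theorem3p2:
  shows
    "(\<forall>(k::nat) (G :: 'a pair_pre_digraph).
        1 \<le> k \<and> pair_graph G \<and> enat k \<le> min_degree G \<longrightarrow>
        (\<exists>V1 V2. good_two_partition k G V1 V2))
     \<and>
     (\<exists>(M::tm) (p :: nat poly).
        wf_tm M \<and> sep_sym < tm_symbols M \<and>
        (\<forall>(k::nat) (n::nat) (G :: nat pair_pre_digraph).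
           1 \<le> k \<and> pair_graph G \<and> pverts G = {..<n} \<and> enat k \<le> min_degree G \<longrightarrow>
           (\<exists>V1 V2 t. good_two_partition k G V1 V2 \<and>
              t \<le> poly p (length (encode_instance k n G)) \<and>
              tm_computes_within M (encode_instance k n G) (encode_partition n V2) t)))"
proof (intro conjI allI impI)
  fix k :: nat and G :: "'a pair_pre_digraph"
  assume kG: "1 \<le> k \<and> pair_graph G \<and> enat k \<le> min_degree G"
  then obtain S where "independent_set G S" "\<forall>v\<in>pverts G - S. \<exists>u\<in>S. (v, u) \<in> parcs G"
    using ex_maximal_independent_set by blast
  then have "good_two_partition k G (pverts G - S) S"
    using kG by (intro good_two_partition_independent_dominating) auto
  then show "\<exists>V1 V2. good_two_partition k G V1 V2" by blast
next
  have "\<exists>V1 V2 t. good_two_partition k G V1 V2 \<and>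
      t \<le> poly [:0, 4:] (length (encode_instance k n G)) \<and>
      tm_computes_within greedy_tm (encode_instance k n G) (encode_partition n V2) t"
    if G: "pair_graph G" "pverts G = {..<n}" "enat k \<le> min_degree G" for k n G
  proof -
    from greedy_tm_computes[of k n G] obtain t where
      t: "t \<le> length (binary k) + n * (2 * n + 4) + 2"
      and run: "tm_computes_within greedy_tm (encode_instance k n G)
        (encode_partition n (greedy_set (parcs G) n)) t"
      by blast
    \<comment> \<open>The input has length \<open>length (binary k) + n^2 + n + 1\<close>, and four
      times this exceeds \<open>length (binary k) + 2 * n^2 + 4 * n + 2\<close>.\<close>
    have "t \<le> poly [:0, 4:] (length (encode_instance k n G))"
      using t by (simp add: length_encode_instance algebra_simps)
    with run good_two_partition_greedy_set[OF G] show ?thesis by blast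
  qed
  moreover have "sep_sym < tm_symbols greedy_tm" by (simp add: greedy_tm_def sep_sym_def)
  ultimately show "\<exists>(M::tm) (p :: nat poly).
        wf_tm M \<and> sep_sym < tm_symbols M \<and>
        (\<forall>(k::nat) (n::nat) (G :: nat pair_pre_digraph).
           1 \<le> k \<and> pair_graph G \<and> pverts G = {..<n} \<and> enat k \<le> min_degree G \<longrightarrow>
           (\<exists>V1 V2 t. good_two_partition k G V1 V2 \<and>
              t \<le> poly p (length (encode_instance k n G)) \<and>
              tm_computes_within M (encode_instance k n G) (encode_partition n V2) t))"
    using wf_greedy_tm by blast
qed

end
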